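(* Let $n\ge1$, let $\mathcal{A}=(A_1,\ldots,A_n)$ be a sequence of nonempty finite sets of positive real numbers and $\mathcal{B}=(B_1,\ldots,B_n)$ a sequence of infinite discrete sets of positive real numbers. Then the set \[ \mathcal{E}^{\pm}(\mathcal{A},\mathcal{B})=\Big\{\sum_{i=1}^n \frac{\varepsilon_i a_i}{b_i} : a_i\in A_i,\ b_i\in B_i,\ \varepsilon_i\in\{1,-1\} \text{ for } i\in\{1,\ldots,n\}\Big\} \] is nowhere dense in $\mathbf{R}$.
   Context: A set $B$ of real numbers is discrete if $B\cap X$ is finite for every bounded set $X\subseteq\mathbf{R}$. *)

theory Defs
  imports "HOL-Analysis.Analysis"
begin

text \<open>
  This is stronger than \<^const>\<open>discrete\<close> from the library, which only asks that every point
  of the set be isolated in it.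
\<close>

definition discrete_reals :: "real set \<Rightarrow> bool" where
  "discrete_reals B \<longleftrightarrow> (\<forall>X. bounded X \<longrightarrow> finite (B \<inter> X))"

definition nowhere_dense :: "'a::topological_space set \<Rightarrow> bool" where
  "nowhere_dense S \<longleftrightarrow> interior (closure S) = {}"

text \<open>
  The sequences of sets are functions on \<^typ>\<open>nat\<close> of which only the values at
  \<open>1, \<dots>, n\<close> are used; the elements \<open>a\<close>, \<open>b\<close> and the signs \<open>e\<close> are likewise unconstrained
  outside \<open>{1..n}\<close>.
\<close>

definition signed_fractions ::
  "nat \<Rightarrow> (nat \<Rightarrow> real set) \<Rightarrow> (nat \<Rightarrow> real set) \<Rightarrow> real set" where
  "signed_fractions n A B =
     {\<Sum>i=1..n. e i * a i / b i | a b e.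
        \<forall>i\<in>{1..n}. a i \<in> A i \<and> b i \<in> B i \<and> e i \<in> {1, -1}}"

end

theory Submission
  imports Defs
begin

text \<open>
  The set of values \<open>\<plusminus> a / b\<close> with \<open>a\<close> in a finite set and \<open>b\<close> in a discrete set
  accumulates only at \<open>0\<close>, so adding the point \<open>0\<close> makes it compact and countable. A finite sum
  of compact countable sets is again compact and countable. Hence the closure of the set of all
  sums is countable, and a countable set of reals has empty interior.
\<close>

text \<open>Whichever member of an open cover contains \<open>x\<close> also contains a ball about
  \<open>x\<close>; only finitely many points of \<open>C\<close> lie outside that ball, so finitely
  many further members cover them.\<close>

lemma compact_insert_accumulation_point:
  fixes x :: "'a::metric_space"
  assumes "\<And>e. e > 0 \<Longrightarrow> finite (C - ball x e)"
  shows "compact (insert x C)"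
proof (rule compactI)
  fix \<C> :: "'a set set"
  assume op: "\<forall>T\<in>\<C>. open T" and cov: "insert x C \<subseteq> \<Union>\<C>"
  then obtain T where T: "T \<in> \<C>" "x \<in> T" "open T"
    by blast
  then obtain e where e: "e > 0" "ball x e \<subseteq> T"
    by (meson open_contains_ball)
  obtain F where F: "finite F" "F \<subseteq> \<C>" "C - ball x e \<subseteq> \<Union>F"
    using finite_subset_Union[OF assms[OF e(1)], of \<C>] cov by blast
  have "insert x C \<subseteq> \<Union>(insert T F)"
    using F(3) e(2) T(2) by auto
  then show "\<exists>\<D>\<subseteq>\<C>. finite \<D> \<and> insert x C \<subseteq> \<Union>\<D>"
    using F T(1) by (intro exI[of _ "insert T F"]) auto
qed

text \<open>Every point other than \<open>x\<close> lies outside some ball of radius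
  \<open>1 / (k + 1)\<close> about \<open>x\<close>, so \<open>C\<close> is covered by
  \<open>x\<close> and countably many finite sets.\<close>

lemma countable_of_accumulation_point:
  fixes x :: "'a::metric_space"
  assumes "\<And>e. e > 0 \<Longrightarrow> finite (C - ball x e)"
  shows "countable C"
proof (rule countable_subset)
  show "C \<subseteq> insert x (\<Union>k. C - ball x (1 / real (Suc k)))"
  proof
    fix y assume y: "y \<in> C"
    show "y \<in> insert x (\<Union>k. C - ball x (1 / real (Suc k)))"
    proof (cases "y = x")
      case False
      then obtain k where "1 / real (Suc k) < dist x y"
        using nat_approx_posE[of "dist x y"] by auto
      with y have "y \<in> C - ball x (1 / real (Suc k))"
        by auto
      then show ?thesis by blast
    qed simp
  qed
  show "countable (insert x (\<Union>k. C - ball x (1 / real (Suc k))))"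
    using assms by (intro countable_insert countable_UN) (auto intro: countable_finite)
qed

text \<open>A fraction of absolute value at least \<open>r\<close> has a denominator of at most
  \<open>Max A / r\<close>. Discreteness of \<open>B\<close> leaves finitely many such denominators,
  and numerators and signs are finite in number anyway.\<close>

lemma finite_signed_fractions_away_from_zero:
  assumes "finite A" "\<forall>a\<in>A. 0 < a" "discrete_reals B" "\<forall>b\<in>B. 0 < b" "r > 0"
  shows "finite ({e * a / b | e a b. e \<in> {1, -1} \<and> a \<in> A \<and> b \<in> B} - ball 0 r)"
proof (rule finite_subset)
  define f :: "real \<times> real \<times> real \<Rightarrow> real" where "f = (\<lambda>(e, a, b). e * a / b)"
  define D :: "(real \<times> real \<times> real) set" where "D = {1, -1} \<times> A \<times> (B \<inter> {0..Max A / r})"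
  show "{e * a / b | e a b. e \<in> {1, -1} \<and> a \<in> A \<and> b \<in> B} - ball 0 r \<subseteq> f ` D"
  proof
    fix y assume y: "y \<in> {e * a / b | e a b. e \<in> {1, -1} \<and> a \<in> A \<and> b \<in> B} - ball 0 r"
    then obtain e a b where eab: "y = e * a / b" "e \<in> {1, -1}" "a \<in> A" "b \<in> B"
      by blast
    have pos: "0 < a" "0 < b" using eab assms by auto
    \<comment> \<open>The sign disappears in the absolute value:
      \<open>\<bar>y\<bar> = a / b\<close>, and \<open>y\<close> lies outside the open ball of
      radius \<open>r\<close> about 0.\<close>
    have "r \<le> a / b" using y eab(1,2) pos by (auto simp: dist_norm)
    then have "b \<le> a / r" using pos assms(5) by (simp add: field_simps)
    also have "\<dots> \<le> Max A / r"
      using assms(1,5) eab(3) by (simp add: divide_right_mono)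
    finally have "(e, a, b) \<in> D" using eab pos by (auto simp: D_def)
    then show "y \<in> f ` D" using eab(1) by (force simp: f_def)
  qed
  show "finite (f ` D)"
    using assms(1,3) by (auto simp: D_def discrete_reals_def)
qed

text \<open>Induction on \<open>n\<close>: the next \<open>S\<close> is the Minkowski sum of the
  previous one with \<open>K (Suc n)\<close>, and such a sum inherits compactness and countability.
  A set containing all the sums suffices, since it only has to bound their closure from
  above.\<close>

lemma sums_subset_countable_compact:
  fixes K :: "nat \<Rightarrow> 'a::real_normed_vector set"
  assumes "\<And>i. i \<in> {1..n} \<Longrightarrow> compact (K i) \<and> countable (K i)"
  shows "\<exists>S. compact S \<and> countable S \<and> (\<forall>x. (\<forall>i\<in>{1..n}. x i \<in> K i) \<longrightarrow> (\<Sum>i=1..n. x i) \<in> S)"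
  using assms
proof (induction n)
  case 0
  then show ?case by (intro exI[of _ "{0}"]) auto
next
  case (Suc n)
  then obtain S where S: "compact S" "countable S"
    "\<And>x. \<forall>i\<in>{1..n}. x i \<in> K i \<Longrightarrow> (\<Sum>i=1..n. x i) \<in> S"
    by (metis atLeastAtMost_iff le_SucI)
  have K: "compact (K (Suc n))" "countable (K (Suc n))"
    using Suc.prems by auto
  let ?T = "{x + y | x y. x \<in> S \<and> y \<in> K (Suc n)}"
  have "?T = (\<lambda>(x, y). x + y) ` (S \<times> K (Suc n))" by auto
  then have "countable ?T" using S(2) K(2) by simp
  moreover have "compact ?T" using compact_sums[OF S(1) K(1)] .
  moreover have "(\<Sum>i=1..Suc n. x i) \<in> ?T" if "\<forall>i\<in>{1..Suc n}. x i \<in> K i" for x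
  proof -
    have "(\<Sum>i=1..n. x i) \<in> S" "x (Suc n) \<in> K (Suc n)" using S(3) that by auto
    then show ?thesis by auto
  qed
  ultimately show ?case by blast
qed

text \<open>The closure of \<open>S\<close> stays inside \<open>T\<close>, whereas an interior point
  of it would bring in a whole ball, which is uncountable.\<close>

lemma nowhere_dense_subset_countable_closed:
  fixes S T :: "'a::euclidean_space set"
  assumes "S \<subseteq> T" "closed T" "countable T"
  shows "nowhere_dense S"
proof (rule ccontr)
  assume "\<not> nowhere_dense S"
  then obtain x where "x \<in> interior (closure S)"
    by (auto simp: nowhere_dense_def)
  then obtain e where "e > 0" "ball x e \<subseteq> closure S"
    by (auto simp: mem_interior)
  moreover have "closure S \<subseteq> T" using assms by (simp add: closure_minimal)
  ultimately show False
    using assms(3) uncountable_ball[of e x] by (meson countable_subset order_trans)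
qed

theorem theorem4:
  fixes n :: nat and A B :: "nat \<Rightarrow> real set"
  assumes "n \<ge> 1"
    and "\<And>i. i \<in> {1..n} \<Longrightarrow> finite (A i) \<and> A i \<noteq> {} \<and> (\<forall>a\<in>A i. 0 < a)"
    and "\<And>i. i \<in> {1..n} \<Longrightarrow> infinite (B i) \<and> discrete_reals (B i) \<and> (\<forall>b\<in>B i. 0 < b)"
  shows "nowhere_dense (signed_fractions n A B)"
proof -
  \<comment> \<open>\<open>C i\<close> collects the possible values of the \<open>i\<close>-th
    summand; its only possible accumulation point is 0.\<close>
  define C where "C i = {e * a / b | e a b. e \<in> {1, -1} \<and> a \<in> A i \<and> b \<in> B i}" for i
  have fin: "finite (C i - ball 0 r)" if "i \<in> {1..n}" "r > 0" for i r
    unfolding C_def using assms(2,3)[OF that(1)] that(2)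
    by (intro finite_signed_fractions_away_from_zero) auto
  have "compact (insert 0 (C i)) \<and> countable (insert 0 (C i))" if "i \<in> {1..n}" for i
    using compact_insert_accumulation_point[OF fin[OF that]]
      countable_of_accumulation_point[OF fin[OF that]] by simp
  then obtain S where S: "compact S" "countable S"
    "\<And>x. \<forall>i\<in>{1..n}. x i \<in> insert 0 (C i) \<Longrightarrow> (\<Sum>i=1..n. x i) \<in> S"
    using sums_subset_countable_compact[of n "\<lambda>i. insert 0 (C i)"] by blast
  have "signed_fractions n A B \<subseteq> S"
  proof
    fix y assume "y \<in> signed_fractions n A B"
    then obtain a b e where y: "y = (\<Sum>i=1..n. e i * a i / b i)"
      and "\<forall>i\<in>{1..n}. a i \<in> A i \<and> b i \<in> B i \<and> e i \<in> {1, -1}"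
      unfolding signed_fractions_def by blast
    then have "\<forall>i\<in>{1..n}. e i * a i / b i \<in> insert 0 (C i)"
      unfolding C_def by blast
    then show "y \<in> S" unfolding y by (rule S(3))
  qed
  then show ?thesis
    using nowhere_dense_subset_countable_closed compact_imp_closed S(1,2) by blast
qed

end
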